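(* Let $\phi=\frac{1+\sqrt5}{2}$. Then $$\operatorname{Li}_2\left(\frac12\phi-\frac12\sqrt{\frac{\phi^2+2}{\phi^3}}\right)-\operatorname{Li}_2\left(\frac{1}{2\phi^2}-\frac12\sqrt{\frac{\phi^2+2}{\phi^3}}\right)=\frac{\pi^2}{10}+\ln^2(\phi)+2\ln(\phi)\ln\left(-\frac{1}{2\phi}+\frac12\sqrt{\frac{\phi^2+2}{\phi}}\right).$$
   Context: $\operatorname{Li}_2(z)=\sum_{k\ge1}z^k/k^2$ for $|z|\le 1$ is the dilogarithm; $\ln$ is the natural logarithm and $\ln^2(y)=(\ln y)^2$. *)

theory Defs
  imports "HOL-Analysis.Analysis"
begin

text \<open>
  The sum is shifted to start at index 0. The polymorphic definition covers both the complex
  dilogarithm and its restriction to the reals. It is meaningful only for \<open>norm z \<le> 1\<close>, where the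
  series converges (lemma \<open>Li2_sums\<close>).
\<close>

definition Li2 :: "'a :: {real_normed_field, banach} \<Rightarrow> 'a" where
  "Li2 z = (\<Sum>k. z ^ Suc k / of_nat (Suc k) ^ 2)"

lemma Li2_sums:
  fixes z :: "'a :: {real_normed_field, banach}"
  assumes "norm z \<le> 1"
  shows "(\<lambda>k. z ^ Suc k / of_nat (Suc k) ^ 2) sums Li2 z"
proof -
  have "summable (\<lambda>k. 1 / real (k + 1) ^ 2)"
    using inverse_squares_sums by (simp add: sums_iff)
  moreover have "norm (z ^ Suc k / of_nat (Suc k) ^ 2) \<le> 1 / real (k + 1) ^ 2" for k
  proof -
    have "norm z ^ Suc k \<le> 1"
      using assms by (intro power_le_one) auto
    moreover have "norm (z ^ Suc k / of_nat (Suc k) ^ 2) = norm z ^ Suc k / real (k + 1) ^ 2"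
      by (simp only: norm_divide norm_power norm_of_nat Suc_eq_plus1)
    ultimately show ?thesis
      by (simp only:) (intro divide_right_mono, auto)
  qed
  ultimately have "summable (\<lambda>k. z ^ Suc k / of_nat (Suc k) ^ 2)"
    by (rule summable_comparison_test')
  then show ?thesis
    unfolding Li2_def by (rule summable_sums)
qed

lemma Li2_of_real:
  assumes "\<bar>x\<bar> \<le> 1"
  shows "Li2 (of_real x :: 'a :: {real_normed_field, banach}) = of_real (Li2 x)"
proof -
  have "(\<lambda>k. of_real (x ^ Suc k / of_nat (Suc k) ^ 2) :: 'a) sums of_real (Li2 x)"
    using Li2_sums[of x] assms by (intro sums_of_real) auto
  then have "(\<lambda>k. (of_real x :: 'a) ^ Suc k / of_nat (Suc k) ^ 2) sums of_real (Li2 x)"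
    by (simp only: of_real_divide of_real_power of_real_of_nat_eq)
  then show ?thesis
    unfolding Li2_def[of "of_real x :: 'a"] by (rule sums_unique[symmetric])
qed

end

theory Submission
  imports Defs "HOL-Real_Asymp.Real_Asymp"
begin

text \<open>
  Let \<open>c\<close> be the argument of the last logarithm. Then \<open>\<phi> c\<^sup>2 + c = 1\<close>, and the two arguments of
  the dilogarithm are \<open>c\<^sup>2\<close> and \<open>- c / \<phi>\<close>. In terms of the Rogers dilogarithm
  \<open>L x = Li2 x + ln x ln (1 - x) / 2\<close>, Landen's transformation of \<open>- c / \<phi>\<close> turns the claim into
  \<open>L (c\<^sup>2) + L (\<phi> c\<^sup>3) = \<pi>\<^sup>2 / 10\<close>. This follows from the pentagon relation for the pair
  \<open>\<phi>\<^sup>2 c\<^sup>2, 1 / \<phi>\<^sup>2\<close>, the duplication formula at \<open>1 / \<phi>\<close>, \<open>c\<close> and \<open>\<phi> c\<close>, and the reflection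
  formula, because \<open>1 \<plusminus> c\<close>, \<open>1 - \<phi>\<^sup>2 c\<^sup>2\<close>, \<open>1 + \<phi> c\<close> and \<open>1 + c / \<phi>\<close> are all monomials in \<open>\<phi>\<close> and \<open>c\<close>.
\<close>

section \<open>The real dilogarithm\<close>

lemma Li2_0 [simp]: "Li2 (0 :: real) = 0"
  by (simp add: Li2_def)

lemma Li2_1: "Li2 (1 :: real) = pi\<^sup>2 / 6"
proof -
  have "(\<lambda>k. 1 / (real k + 1)\<^sup>2) sums Li2 1"
    using Li2_sums[of "1::real"] by (simp add: add.commute)
  moreover have "(\<lambda>k. 1 / (real k + 1)\<^sup>2) sums (pi\<^sup>2 / 6)"
    using inverse_squares_sums by (simp add: add.commute)
  ultimately show ?thesis
    by (rule sums_unique2)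
qed

text \<open>The closed interval matters: continuity at the endpoint 1 brings \<open>Li2 1\<close>
  into the reflection formula. Continuity at 0, which \<open>DERIV_Li2\<close> leaves out, also
  comes from here.\<close>

lemma continuous_on_Li2: "continuous_on {-1..1::real} Li2"
proof -
  let ?f = "\<lambda>k (x::real). x ^ Suc k / of_nat (Suc k) ^ 2"
  have "uniform_limit {-1..1} (\<lambda>n x. \<Sum>k<n. ?f k x) (\<lambda>x. \<Sum>k. ?f k x) sequentially"
  proof (rule Weierstrass_m_test)
    show "summable (\<lambda>n. 1 / real (n + 1) ^ 2)"
      using inverse_squares_sums by (simp add: sums_iff)
    fix n and x :: real
    assume "x \<in> {-1..1}"
    then have "\<bar>x\<bar> ^ Suc n \<le> 1"
      by (intro power_le_one) auto
    then show "norm (?f n x) \<le> 1 / real (n + 1) ^ 2"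
      unfolding real_norm_def abs_divide power_abs
      by (simp del: power_Suc add: divide_right_mono)
  qed
  then have "continuous_on {-1..1} (\<lambda>x. \<Sum>k. ?f k x)"
    by (rule uniform_limit_theorem[rotated]) (auto intro!: always_eventually continuous_intros)
  then show ?thesis
    by (simp only: Li2_def[abs_def])
qed

text \<open>Termwise differentiation gives the series of \<open>- ln (1 - x) / x\<close>. At 0 the
  true derivative is 1, whereas the quotient evaluates to 0 there by the convention for division by
  zero.\<close>

lemma DERIV_Li2:
  fixes x :: real
  assumes "\<bar>x\<bar> < 1" "x \<noteq> 0"
  shows "(Li2 has_real_derivative - ln (1 - x) / x) (at x)"
proof -
  let ?f = "\<lambda>n. 1 / real (Suc n) ^ 2"
  have f_eq: "?f n * real (Suc n) * y ^ n = y ^ n / real (Suc n)" for n and y :: real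
    by (simp add: power2_eq_square)
  have "DERIV (\<lambda>x. \<Sum>n. ?f n * x ^ Suc n) x :> (\<Sum>n. ?f n * real (Suc n) * x ^ n)"
  proof (rule DERIV_power_series'[where R = 1])
    fix y :: real
    assume y: "y \<in> {-1<..<1}"
    have "summable (\<lambda>n. \<bar>y\<bar> ^ n)"
      using y by (intro summable_geometric) auto
    then show "summable (\<lambda>n. ?f n * real (Suc n) * y ^ n)"
      unfolding f_eq
      by (rule summable_comparison_test'[where N = 0])
        (simp add: power_abs divide_le_eq mult_left_le mult_le_cancel_left1)
  qed (use assms in auto)
  moreover have "(\<lambda>n. y ^ n / real (Suc n)) sums (- ln (1 - y) / y)"
    if "\<bar>y\<bar> < 1" "y \<noteq> 0" for y :: real
  proof -
    have "(\<lambda>n. - (y ^ n) / of_nat n) sums ln (1 - y)"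
      using ln_series'[of "-y"] that by simp
    \<comment> \<open>The shift of index costs nothing: the term at 0 is a division by zero, hence
      0.\<close>
    then have "(\<lambda>n. - (y ^ Suc n) / of_nat (Suc n)) sums ln (1 - y)"
      by (subst sums_Suc_iff) simp
    then have "(\<lambda>n. - (y ^ Suc n) / of_nat (Suc n) * (- 1 / y)) sums (ln (1 - y) * (- 1 / y))"
      by (rule sums_mult2)
    then show ?thesis
      using that by (simp add: field_simps)
  qed
  ultimately have "DERIV (\<lambda>x. \<Sum>n. ?f n * x ^ Suc n) x :> - ln (1 - x) / x"
    using assms unfolding f_eq by (simp add: sums_iff)
  then show ?thesis
    unfolding Li2_def[abs_def] by (simp only: times_divide_eq_left mult_1 of_nat_power)
qed

lemma isCont_Li2_0: "isCont Li2 (0::real)"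
  using continuous_on_interior[OF continuous_on_Li2, of 0] by simp

text \<open>Common scheme for the functional equations below. The constant is read off from a
  one-sided limit because \<open>ln x\<close> in \<open>Rogers_L\<close> is singular at 0.\<close>

lemma eq_limit_at_right_0_if_DERIV_0:
  fixes f :: "real \<Rightarrow> real"
  assumes deriv: "\<And>x. 0 < x \<Longrightarrow> x < 1 \<Longrightarrow> (f has_real_derivative 0) (at x)"
    and lim: "(f \<longlongrightarrow> l) (at_right 0)"
    and "0 < x" "x < 1"
  shows "f x = l"
proof -
  have "\<exists>c. \<forall>x\<in>{0<..<1}. f x = c"
    by (rule has_field_derivative_zero_constant)
      (auto intro: has_field_derivative_at_within deriv)
  then obtain c where c: "\<And>x. 0 < x \<Longrightarrow> x < 1 \<Longrightarrow> f x = c"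
    by auto
  have "eventually (\<lambda>x. f x = c) (at_right 0)"
    unfolding eventually_at_right_field by (rule exI[of _ 1]) (auto intro: c)
  then have "(f \<longlongrightarrow> c) (at_right 0)"
    by (rule tendsto_eventually)
  then have "l = c"
    using lim by (intro tendsto_unique[of "at_right 0"]) auto
  then show ?thesis
    using c assms by simp
qed

text \<open>Since \<open>1 - y / (1 + y)\<close> is \<open>1 / (1 + y)\<close>, every derivative is
  a rational multiple of \<open>ln (1 + y)\<close>, and they cancel by partial fractions of
  \<open>1 / (y * (1 + y))\<close>. Everything vanishes at 0.\<close>

lemma Li2_Landen:
  fixes y :: real
  assumes "0 < y" "y < 1"
  shows "Li2 (- y) + Li2 (y / (1 + y)) = - (ln (1 + y))\<^sup>2 / 2"
proof -
  let ?f = "\<lambda>y::real. Li2 (- y) + Li2 (y / (1 + y)) + (ln (1 + y))\<^sup>2 / 2"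
  have "?f y = 0"
  proof (rule eq_limit_at_right_0_if_DERIV_0[OF _ _ assms])
    fix y :: real
    assume y: "0 < y" "y < 1"
    have "1 - y / (1 + y) = inverse (1 + y)"
      using y by (simp add: field_simps)
    then have l: "ln (1 - y / (1 + y)) = - ln (1 + y)"
      using y by (simp add: ln_inverse)
    have 1: "((\<lambda>y. Li2 (- y)) has_real_derivative (- ln (1 - (- y)) / (- y)) * (- 1)) (at y)"
      by (rule DERIV_chain2[OF DERIV_Li2]) (use y in \<open>auto intro!: derivative_eq_intros\<close>)
    have 2: "((\<lambda>y. Li2 (y / (1 + y))) has_real_derivative
        (- ln (1 - y / (1 + y)) / (y / (1 + y))) * (1 / (1 + y)\<^sup>2)) (at y)"
      by (rule DERIV_chain2[OF DERIV_Li2])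
        (use y in \<open>auto intro!: derivative_eq_intros simp: field_simps power2_eq_square\<close>)
    have 3: "((\<lambda>y. (ln (1 + y))\<^sup>2 / 2) has_real_derivative ln (1 + y) / (1 + y)) (at y)"
      using y by (auto intro!: derivative_eq_intros simp: field_simps)
    have "(- ln (1 - (- y)) / (- y)) * (- 1)
        + (- ln (1 - y / (1 + y)) / (y / (1 + y))) * (1 / (1 + y)\<^sup>2) + ln (1 + y) / (1 + y) = 0"
      unfolding l using y by (simp add: divide_simps power2_eq_square) algebra
    then show "(?f has_real_derivative 0) (at y)"
      using DERIV_add[OF DERIV_add[OF 1 2] 3] by simp
  next
    have "isCont ?f 0"
      by (intro continuous_intros isCont_o2[of 0 _ Li2]) (auto simp: isCont_Li2_0)
    then show "(?f \<longlongrightarrow> 0) (at_right 0)"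
      using filterlim_at_split isCont_def by force
  qed
  then show ?thesis by simp
qed

section \<open>The Rogers dilogarithm\<close>

text \<open>The correction term absorbs the products of logarithms, so that the functional equations
  become linear relations among values of \<open>Rogers_L\<close> and a constant.\<close>

definition Rogers_L :: "real \<Rightarrow> real" where
  "Rogers_L x = Li2 x + ln x * ln (1 - x) / 2"

lemma DERIV_Rogers_L:
  assumes "0 < x" "x < 1"
  shows "(Rogers_L has_real_derivative - (ln (1 - x) / x + ln x / (1 - x)) / 2) (at x)"
  unfolding Rogers_L_def[abs_def]
  by (rule derivative_eq_intros DERIV_Li2 refl | use assms in \<open>simp; fail\<close>)+
    (use assms in \<open>simp add: field_simps\<close>)

lemma tendsto_Rogers_L_at_right_0: "(Rogers_L \<longlongrightarrow> 0) (at_right 0)"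
proof -
  have "(Li2 \<longlongrightarrow> 0) (at_right (0::real))"
    using isCont_Li2_0 filterlim_at_split isCont_def by force
  moreover have "((\<lambda>x::real. ln x * ln (1 - x) / 2) \<longlongrightarrow> 0) (at_right 0)"
    by real_asymp
  ultimately have "((\<lambda>x. Li2 x + ln x * ln (1 - x) / 2) \<longlongrightarrow> 0 + 0) (at_right (0::real))"
    by (rule tendsto_add)
  then show ?thesis
    by (simp add: Rogers_L_def[abs_def])
qed

text \<open>The derivative of \<open>Rogers_L\<close> is symmetric under replacing \<open>x\<close>
  by \<open>1 - x\<close>, so the chain rule sign makes the two contributions cancel. The limit at 0
  is \<open>Li2 1\<close>.\<close>

lemma Rogers_L_reflection:
  assumes "0 < x" "x < 1"
  shows "Rogers_L x + Rogers_L (1 - x) = pi\<^sup>2 / 6"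
proof (rule eq_limit_at_right_0_if_DERIV_0[OF _ _ assms])
  fix x :: real
  assume x: "0 < x" "x < 1"
  have "((\<lambda>x. Rogers_L (1 - x)) has_real_derivative
      (- (ln (1 - (1 - x)) / (1 - x) + ln (1 - x) / (1 - (1 - x))) / 2) * (- 1)) (at x)"
    by (rule DERIV_chain2[OF DERIV_Rogers_L]) (use x in \<open>auto intro!: derivative_eq_intros\<close>)
  from DERIV_add[OF DERIV_Rogers_L[OF x] this]
  show "((\<lambda>x. Rogers_L x + Rogers_L (1 - x)) has_real_derivative 0) (at x)"
    by (simp add: add.commute)
next
  have "((\<lambda>x. Li2 (1 - x)) \<longlongrightarrow> Li2 (1::real)) (at_right 0)"
  proof (rule continuous_on_tendsto_compose[OF continuous_on_Li2])
    show "((\<lambda>x. 1 - x) \<longlongrightarrow> (1::real)) (at_right 0)"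
      by real_asymp
    show "\<forall>\<^sub>F x::real in at_right 0. 1 - x \<in> {-1..1}"
      unfolding eventually_at_right_field by (rule exI[of _ 1]) auto
  qed simp
  moreover have "((\<lambda>x::real. ln (1 - x) * ln (1 - (1 - x)) / 2) \<longlongrightarrow> 0) (at_right 0)"
    by real_asymp
  ultimately have "((\<lambda>x. Rogers_L (1 - x)) \<longlongrightarrow> Li2 1 + 0) (at_right 0)"
    unfolding Rogers_L_def by (rule tendsto_add)
  from tendsto_add[OF tendsto_Rogers_L_at_right_0 this]
  show "((\<lambda>x. Rogers_L x + Rogers_L (1 - x)) \<longlongrightarrow> pi\<^sup>2 / 6) (at_right 0)"
    by (simp add: Li2_1)
qed

text \<open>With \<open>y\<close> fixed, differentiate in \<open>x\<close>. As \<open>x\<close>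
  tends to 0, all arguments that depend on \<open>x\<close> tend to 0, except the last one, which
  tends to \<open>y\<close>.\<close>

lemma Rogers_L_pentagon:
  assumes "0 < x" "x < 1" "0 < y" "y < 1"
  shows "Rogers_L x + Rogers_L y = Rogers_L (x * y)
           + Rogers_L (x * (1 - y) / (1 - x * y)) + Rogers_L (y * (1 - x) / (1 - x * y))"
proof -
  let ?P = "\<lambda>x. x * (1 - y) / (1 - x * y)" and ?Q = "\<lambda>x. y * (1 - x) / (1 - x * y)"
  let ?f = "\<lambda>x. Rogers_L x - Rogers_L (x * y) - Rogers_L (?P x) - Rogers_L (?Q x)"
  have "?f x = - Rogers_L y"
  proof (rule eq_limit_at_right_0_if_DERIV_0[OF _ _ assms(1,2)])
    fix x :: real
    assume x: "0 < x" "x < 1"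
    define u v w where "u = 1 - x" and "v = 1 - y" and "w = 1 - x * y"
    have xy: "0 < x * y" "x * y < 1"
      using x assms mult_strict_mono[of x 1 y 1] by auto
    have pos: "0 < u" "0 < v" "0 < w"
      using x assms xy by (auto simp: u_def v_def w_def)
    have P1: "1 - ?P x = u / w" and Q1: "1 - ?Q x = v / w"
      using pos by (auto simp: u_def v_def w_def field_simps)
    have "0 < 1 - ?P x" "0 < 1 - ?Q x"
      unfolding P1 Q1 using pos by auto
    then have P: "0 < ?P x" "?P x < 1" and Q: "0 < ?Q x" "?Q x < 1"
      using pos x assms by (auto simp: u_def v_def w_def)
    have 1: "((\<lambda>x. Rogers_L (x * y)) has_real_derivative
        (- (ln (1 - x * y) / (x * y) + ln (x * y) / (1 - x * y)) / 2) * y) (at x)"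
      by (rule DERIV_chain2[OF DERIV_Rogers_L]) (use xy in \<open>auto intro!: derivative_eq_intros\<close>)
    have 2: "((\<lambda>x. Rogers_L (?P x)) has_real_derivative
        (- (ln (1 - ?P x) / ?P x + ln (?P x) / (1 - ?P x)) / 2) * (v / w\<^sup>2)) (at x)"
      by (rule DERIV_chain2[where g = ?P, OF DERIV_Rogers_L[OF P]])
        (use pos in \<open>auto intro!: derivative_eq_intros
          simp: u_def v_def w_def field_simps power2_eq_square\<close>)
    have 3: "((\<lambda>x. Rogers_L (?Q x)) has_real_derivative
        (- (ln (1 - ?Q x) / ?Q x + ln (?Q x) / (1 - ?Q x)) / 2) * (- y * v / w\<^sup>2)) (at x)"
      by (rule DERIV_chain2[where g = ?Q, OF DERIV_Rogers_L[OF Q]])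
        (use pos in \<open>auto intro!: derivative_eq_intros
          simp: u_def v_def w_def field_simps power2_eq_square\<close>)
    have lnP: "ln (?P x) = ln x + ln v - ln w" and lnQ: "ln (?Q x) = ln y + ln u - ln w"
      and lnuw: "ln (u / w) = ln u - ln w" and lnvw: "ln (v / w) = ln v - ln w"
      and lnxy: "ln (x * y) = ln x + ln y"
      using pos x assms by (auto simp: u_def[symmetric] v_def[symmetric] w_def[symmetric] ln_mult ln_div)
    \<comment> \<open>\<open>A\<close>, \<open>B\<close>, \<open>C\<close>, \<open>D\<close>,
      \<open>E\<close> stand for the logarithms of \<open>x\<close>, \<open>u\<close>,
      \<open>w\<close>, \<open>y\<close>, \<open>v\<close>. The cancellation is purely rational, so
      they may be arbitrary; \<open>D\<close> and \<open>E\<close> drop out at once.\<close>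
    have alg: "- (B / x + A / u) / 2 - (- (C / (x * y) + (A + D) / w) / 2) * y
        - (- ((B - C) / (x * v / w) + (A + E - C) / (u / w)) / 2) * (v / w\<^sup>2)
        - (- ((E - C) / (y * u / w) + (D + B - C) / (v / w)) / 2) * (- y * v / w\<^sup>2) = 0"
      (is "?l = 0") for A B C D E
    proof -
      have "?l = (C - B) / 2 * (1 / x - 1 / (x * w) + y / w)
          - A / 2 * (1 / u - y / w - v / (u * w))"
        using pos x assms by (simp add: field_simps power2_eq_square)
      also have "1 / x - 1 / (x * w) + y / w = 0"
        using pos x by (simp add: field_simps) (simp add: w_def algebra_simps)
      also have "1 / u - y / w - v / (u * w) = 0"
        using pos x by (simp add: field_simps) (simp add: w_def u_def v_def algebra_simps)
      finally show ?thesis by simp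
    qed
    have "- (ln (1 - x) / x + ln x / (1 - x)) / 2
        - (- (ln (1 - x * y) / (x * y) + ln (x * y) / (1 - x * y)) / 2) * y
        - (- (ln (1 - ?P x) / ?P x + ln (?P x) / (1 - ?P x)) / 2) * (v / w\<^sup>2)
        - (- (ln (1 - ?Q x) / ?Q x + ln (?Q x) / (1 - ?Q x)) / 2) * (- y * v / w\<^sup>2) = 0"
      unfolding P1 Q1 lnP lnQ lnuw lnvw lnxy
      unfolding u_def[symmetric] v_def[symmetric] w_def[symmetric]
      by (rule alg)
    then show "(?f has_real_derivative 0) (at x)"
      using DERIV_diff[OF DERIV_diff[OF DERIV_diff[OF DERIV_Rogers_L[OF x] 1] 2] 3] by simp
  next
    have small: "((\<lambda>x. Rogers_L (g x)) \<longlongrightarrow> 0) (at_right 0)"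
      if "filterlim g (at_right 0) (at_right 0)" for g :: "real \<Rightarrow> real"
      using filterlim_compose[OF tendsto_Rogers_L_at_right_0 that] .
    have lim1: "filterlim (\<lambda>x. x * y) (at_right 0) (at_right 0)"
      using assms by real_asymp
    \<comment> \<open>Near 0, \<open>?P x\<close> behaves like \<open>(1 - y) * x\<close>, so this
      sign decides that 0 is approached from the right.\<close>
    have v: "1 - y > 0"
      using assms by simp
    have lim2: "filterlim ?P (at_right 0) (at_right 0)"
      using assms v by real_asymp
    have "(?Q \<longlongrightarrow> y) (at_right 0)"
      by (auto intro!: tendsto_eq_intros)
    then have lim3: "((\<lambda>x. Rogers_L (?Q x)) \<longlongrightarrow> Rogers_L y) (at_right 0)"
      by (rule isCont_tendsto_compose[OF DERIV_isCont[OF DERIV_Rogers_L[OF assms(3,4)]]])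
    show "(?f \<longlongrightarrow> - Rogers_L y) (at_right 0)"
      using tendsto_diff[OF tendsto_diff[OF tendsto_diff[OF
          tendsto_Rogers_L_at_right_0 small[OF lim1]] small[OF lim2]] lim3] by simp
  qed
  then show ?thesis by simp
qed

text \<open>The diagonal case of the pentagon relation, where both fractions collapse to
  \<open>x / (1 + x)\<close>.\<close>

lemma Rogers_L_duplication:
  assumes "0 < x" "x < 1"
  shows "Rogers_L (x\<^sup>2) = 2 * Rogers_L x - 2 * Rogers_L (x / (1 + x))"
proof -
  have "1 - x * x = (1 - x) * (1 + x)"
    by (simp add: algebra_simps)
  then have "x * (1 - x) / (1 - x * x) = x / (1 + x)"
    using assms by simp
  then show ?thesis
    using Rogers_L_pentagon[OF assms assms] by (simp add: power2_eq_square)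
qed

text \<open>For this \<open>g\<close>, the inverse golden ratio, duplication and reflection involve
  only the values at \<open>g\<close> and \<open>g\<^sup>2\<close>, and these two linear equations
  determine both.\<close>

lemma Rogers_L_golden:
  assumes "0 < g" "1 - g = g\<^sup>2"
  shows "Rogers_L (g\<^sup>2) = pi\<^sup>2 / 15"
proof -
  have g: "g < 1"
    using assms by (smt (verit) zero_less_power)
  have "g / (1 + g) = g\<^sup>2"
    using assms by (simp add: field_simps power2_eq_square)
  then have "3 * Rogers_L (g\<^sup>2) = 2 * Rogers_L g"
    using Rogers_L_duplication[OF assms(1) g] by simp
  moreover have "Rogers_L g + Rogers_L (g\<^sup>2) = pi\<^sup>2 / 6"
    using Rogers_L_reflection[OF assms(1) g] assms(2) by simp
  ultimately show ?thesis by simp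
qed

section \<open>Dilogarithms at powers of the golden ratio and \<open>c\<close>\<close>

text \<open>Linear elimination: the values at \<open>c\<close> and \<open>p * c\<close> enter only
  through their sum, and what remains is \<open>Rogers_L (p\<^sup>2 * c\<^sup>2) = Rogers_L
  (c\<^sup>2) + pi\<^sup>2 / 15\<close>. Reflection at \<open>p\<^sup>2 * c\<^sup>2\<close> then
  gives the claim.\<close>

lemma Rogers_L_pair:
  fixes p c :: real
  assumes p: "1 < p" "p\<^sup>2 = p + 1" and c: "0 < c" "p * c\<^sup>2 = 1 - c"
  shows "Rogers_L (c\<^sup>2) + Rogers_L (p * c ^ 3) = pi\<^sup>2 / 10"
proof -
  have p0: "0 < p" and c1: "c < 1"
    using p c by (auto, smt (verit) mult_pos_pos zero_less_power)
  \<comment> \<open>The first two serve duplication at \<open>p * c\<close> and \<open>c\<close>,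
    the third is the denominator in the pentagon relation. The last three give the reflections and,
    by positivity of their right-hand sides, the upper bounds 1 on the arguments.\<close>
  have e: "1 + p * c = 1 / c" "(1 + c) * (p ^ 3 * c ^ 3) = 1" "p\<^sup>2 * c * (1 - c\<^sup>2) = 1"
    "1 - p * c = p * c ^ 4" "1 - p ^ 3 * c ^ 4 = p ^ 3 * c ^ 3" "1 - p\<^sup>2 * c\<^sup>2 = p * c ^ 3"
  proof -
    show "1 + p * c = 1 / c"
      using c by (simp add: field_simps power2_eq_square)
    show "(1 + c) * (p ^ 3 * c ^ 3) = 1" "p\<^sup>2 * c * (1 - c\<^sup>2) = 1" "1 - p * c = p * c ^ 4"
      "1 - p ^ 3 * c ^ 4 = p ^ 3 * c ^ 3" "1 - p\<^sup>2 * c\<^sup>2 = p * c ^ 3"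
      using p(2) c(2) by algebra+
  qed
  have pc: "0 < p * c" "p * c < 1"
    using p0 c e(4) by (auto, smt (verit) mult_pos_pos zero_less_power)
  have g: "0 < 1 / p" "1 - 1 / p = (1 / p)\<^sup>2"
    using p0 p by (auto simp: field_simps power2_eq_square)
  have L2: "Rogers_L ((1 / p)\<^sup>2) = pi\<^sup>2 / 15"
    using Rogers_L_golden[OF g] .
  have D: "c / (1 + c) = p ^ 3 * c ^ 4"
    using e(2) c by (simp add: field_simps power_numeral_reduce)
  have dupc: "Rogers_L (c\<^sup>2) = 2 * Rogers_L c - 2 * Rogers_L (p ^ 3 * c ^ 4)"
    using Rogers_L_duplication[OF c(1) c1] D by simp
  have "p * c / (1 + p * c) = 1 - c"
    using e(1) c by (simp add: power2_eq_square)
  then have "Rogers_L (p\<^sup>2 * c\<^sup>2) = 2 * Rogers_L (p * c) - 2 * Rogers_L (1 - c)"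
    using Rogers_L_duplication[OF pc] by (simp add: power_mult_distrib)
  moreover have "Rogers_L c + Rogers_L (1 - c) = pi\<^sup>2 / 6"
    by (rule Rogers_L_reflection) fact+
  moreover have "Rogers_L (p\<^sup>2 * c\<^sup>2) + Rogers_L (p * c ^ 3) = pi\<^sup>2 / 6"
    using Rogers_L_reflection[of "p\<^sup>2 * c\<^sup>2"] pc p0 c(1) e(6) by (smt (verit) mult_pos_pos zero_less_power)
  moreover have "Rogers_L (p * c) + Rogers_L (p * c ^ 4) = pi\<^sup>2 / 6"
    using Rogers_L_reflection[OF pc] e(4) by simp
  moreover have "Rogers_L (p ^ 3 * c ^ 4) + Rogers_L (p ^ 3 * c ^ 3) = pi\<^sup>2 / 6"
    using Rogers_L_reflection[of "p ^ 3 * c ^ 4"] p0 c(1) e(5) by (smt (verit) mult_pos_pos zero_less_power)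
  moreover have "Rogers_L (p\<^sup>2 * c\<^sup>2) + Rogers_L ((1 / p)\<^sup>2)
      = Rogers_L (c\<^sup>2) + Rogers_L (p ^ 3 * c ^ 3) + Rogers_L (p * c ^ 4)"
  proof -
    have w: "1 - c\<^sup>2 = 1 / (p\<^sup>2 * c)"
      using e(3) p0 c(1) by (intro eq_divide_imp) (auto simp: mult_ac)
    have v: "1 - (1 / p)\<^sup>2 = 1 / p"
      using g(2) by simp
    have xy: "p\<^sup>2 * c\<^sup>2 * (1 / p)\<^sup>2 = c\<^sup>2"
      using p0 by (simp add: field_simps)
    have PQ: "p\<^sup>2 * c\<^sup>2 * (1 / p) / (1 / (p\<^sup>2 * c)) = p ^ 3 * c ^ 3"
      "(1 / p)\<^sup>2 * (p * c ^ 3) / (1 / (p\<^sup>2 * c)) = p * c ^ 4"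
      using p0 c(1) by (simp_all add: field_simps power_numeral_reduce)
    have "0 < p\<^sup>2 * c\<^sup>2" "p\<^sup>2 * c\<^sup>2 < 1"
      using p0 c(1) e(6) by (auto, smt (verit) mult_pos_pos zero_less_power)
    moreover have "0 < (1 / p)\<^sup>2" "(1 / p)\<^sup>2 < 1"
      using p0 g by (auto, smt (verit))
    ultimately show ?thesis
      using Rogers_L_pentagon[of "p\<^sup>2 * c\<^sup>2" "(1 / p)\<^sup>2"] unfolding xy v w e(6) PQ by simp
  qed
  ultimately show ?thesis
    using L2 dupc by simp
qed

text \<open>Landen's transformation sends \<open>- (c / p)\<close> to \<open>p * c ^ 3\<close>,
  which leads to the two values in \<open>Rogers_L_pair\<close>. All logarithms are linear in
  \<open>ln p\<close> and \<open>ln c\<close>, so comparing quadratic forms in these finishes the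
  proof.\<close>

lemma Li2_pair:
  fixes p c :: real
  assumes p: "1 < p" "p\<^sup>2 = p + 1" and c: "0 < c" "p * c\<^sup>2 = 1 - c"
  shows "Li2 (c\<^sup>2) - Li2 (- (c / p)) = pi\<^sup>2 / 10 + (ln p)\<^sup>2 + 2 * ln p * ln c"
proof -
  have p0: "0 < p" and c1: "c < 1"
    using p c by (auto, smt (verit) mult_pos_pos zero_less_power)
  have e: "p\<^sup>2 * c * (1 - c\<^sup>2) = 1" "1 - p * c ^ 3 = (p * c)\<^sup>2" "(1 + c / p) * (p * c)\<^sup>2 = 1"
  proof -
    show "p\<^sup>2 * c * (1 - c\<^sup>2) = 1" "1 - p * c ^ 3 = (p * c)\<^sup>2"
      using p(2) c(2) by algebra+
    have "(1 + c / p) * (p * c)\<^sup>2 = (p + c) * (p * c\<^sup>2)"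
      using p0 by (simp add: field_simps power2_eq_square)
    also have "\<dots> = 1"
      using p(2) c(2) by algebra
    finally show "(1 + c / p) * (p * c)\<^sup>2 = 1" .
  qed
  have e': "1 - c\<^sup>2 = 1 / (p\<^sup>2 * c)" "1 + c / p = 1 / (p * c)\<^sup>2"
    using e p0 c(1) by (auto intro!: eq_divide_imp simp: mult_ac)
  have "c / p < 1"
    using p0 p(1) c1 by (simp add: field_simps)
  then have Landen: "Li2 (- (c / p)) + Li2 (c / p / (1 + c / p)) = - (ln (1 + c / p))\<^sup>2 / 2"
    using p0 c(1) by (intro Li2_Landen) auto
  have w: "c / p / (1 + c / p) = p * c ^ 3"
    unfolding e' using p0 by (simp add: field_simps power_numeral_reduce)
  have logs: "ln (1 + c / p) = - 2 * (ln p + ln c)" "ln (1 - c\<^sup>2) = - 2 * ln p - ln c"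
    "ln (1 - p * c ^ 3) = 2 * (ln p + ln c)" "ln (p * c ^ 3) = ln p + 3 * ln c"
    "ln (c\<^sup>2) = 2 * ln c"
    unfolding e' e(2) using p0 c(1) by (simp_all add: ln_div ln_mult ln_realpow)
  from Landen Rogers_L_pair[OF assms] show ?thesis
    unfolding Rogers_L_def w logs by algebra
qed

theorem theorem13:
  fixes \<phi> :: real
  assumes "\<phi> = (1 + sqrt 5) / 2"
  shows "Li2 (1 / 2 * \<phi> - 1 / 2 * sqrt ((\<phi>\<^sup>2 + 2) / \<phi> ^ 3))
           - Li2 (1 / (2 * \<phi>\<^sup>2) - 1 / 2 * sqrt ((\<phi>\<^sup>2 + 2) / \<phi> ^ 3))
         = pi\<^sup>2 / 10 + (ln \<phi>)\<^sup>2
           + 2 * ln \<phi> * ln (- (1 / (2 * \<phi>)) + 1 / 2 * sqrt ((\<phi>\<^sup>2 + 2) / \<phi>))"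
proof -
  define t where "t = sqrt ((\<phi>\<^sup>2 + 2) / \<phi>)"
  define c where "c = - (1 / (2 * \<phi>)) + 1 / 2 * t"
  have p1: "1 < \<phi>"
    unfolding assms by simp
  have p2: "\<phi>\<^sup>2 = \<phi> + 1"
    unfolding assms by (simp add: field_simps power2_eq_square)
  \<comment> \<open>Removing reciprocals and writing both radicals through \<open>t\<close> leaves
    polynomial identities modulo \<open>\<phi>\<^sup>2 = \<phi> + 1\<close> and
    \<open>t\<^sup>2 = 3 * \<phi> - 2\<close>.\<close>
  have inv: "1 / \<phi> = \<phi> - 1" "1 / \<phi>\<^sup>2 = 2 - \<phi>"
    using p1 p2 by (auto simp: field_simps power2_eq_square)
  have t2: "t\<^sup>2 = 3 * \<phi> - 2"
    using p1 p2 by (simp add: t_def field_simps power2_eq_square)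
  have s: "sqrt ((\<phi>\<^sup>2 + 2) / \<phi> ^ 3) = t * (\<phi> - 1)"
  proof -
    have "sqrt ((\<phi>\<^sup>2 + 2) / \<phi> ^ 3) = sqrt ((\<phi>\<^sup>2 + 2) / \<phi> / \<phi>\<^sup>2)"
      by (simp add: power_numeral_reduce)
    also have "\<dots> = t * (1 / \<phi>)"
      using p1 by (simp add: t_def real_sqrt_divide real_sqrt_mult)
    finally show ?thesis
      by (simp only: inv)
  qed
  have c: "c = (t + 1 - \<phi>) / 2"
    using inv(1) by (simp add: c_def field_simps)
  \<comment> \<open>Needed for \<open>0 < c\<close>, which singles out \<open>c\<close> as the
    positive root of \<open>\<phi> * x\<^sup>2 + x = 1\<close>.\<close>
  have "(\<phi> - 1)\<^sup>2 < t\<^sup>2"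
    unfolding t2 using p1 p2 by (simp add: power2_eq_square algebra_simps)
  moreover have "0 \<le> t"
    using p1 by (simp add: t_def)
  ultimately have "\<phi> - 1 < t"
    by (rule power2_less_imp_less)
  then have "0 < c"
    by (simp add: c)
  moreover have "\<phi> * c\<^sup>2 = 1 - c"
    using p2 t2 unfolding c by (simp add: field_simps power2_eq_square) algebra
  ultimately have "Li2 (c\<^sup>2) - Li2 (- (c / \<phi>)) = pi\<^sup>2 / 10 + (ln \<phi>)\<^sup>2 + 2 * ln \<phi> * ln c"
    by (intro Li2_pair p1 p2)
  moreover have "1 / 2 * \<phi> - 1 / 2 * sqrt ((\<phi>\<^sup>2 + 2) / \<phi> ^ 3) = c\<^sup>2"
    using p2 t2 unfolding s c by (simp add: field_simps power2_eq_square)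
  moreover have "1 / (2 * \<phi>\<^sup>2) - 1 / 2 * sqrt ((\<phi>\<^sup>2 + 2) / \<phi> ^ 3) = - (c / \<phi>)"
  proof -
    have divs: "1 / (2 * \<phi>\<^sup>2) = (2 - \<phi>) / 2" "c / \<phi> = c * (\<phi> - 1)"
      unfolding inv[symmetric] by simp_all
    show ?thesis
      using p2 unfolding s divs unfolding c by (simp add: field_simps power2_eq_square)
  qed
  ultimately show ?thesis
    by (simp add: c_def t_def)
qed

end
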